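(* Every strongly $\Delta$-clean ring $R$ is Dedekind-finite, i.e., for all $a,b\in R$, $ab=1$ if and only if $ba=1$.
   Context: Rings are associative with identity, not necessarily commutative. $U(R)$ is the group of (two-sided) units of $R$. Define $\Delta(R)=\{x\in R \mid 1-xu\in U(R)\text{ for all }u\in U(R)\}$. A ring $R$ is strongly $\Delta$-clean if every $a\in R$ can be written $a=e+d$ with $e^2=e\in R$, $d\in\Delta(R)$ and $ed=de$. *)

theory Defs
  imports "HOL-Algebra.Ring"
begin

text \<open>
  The locale \<^locale>\<open>ring\<close> is that of associative rings with identity, not necessarily commutative
  and possibly zero. \<^const>\<open>Units\<close> is the set of two-sided units.
\<close>

definition Delta :: "('a, 'm) ring_scheme \<Rightarrow> 'a set" where
  "Delta R = {x \<in> carrier R. \<forall>u \<in> Units R. \<one>\<^bsub>R\<^esub> \<ominus>\<^bsub>R\<^esub> x \<otimes>\<^bsub>R\<^esub> u \<in> Units R}"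

definition strongly_Delta_clean :: "('a, 'm) ring_scheme \<Rightarrow> bool" where
  "strongly_Delta_clean R \<longleftrightarrow>
     (\<forall>a \<in> carrier R. \<exists>e \<in> carrier R. \<exists>d \<in> Delta R.
        a = e \<oplus>\<^bsub>R\<^esub> d \<and> e \<otimes>\<^bsub>R\<^esub> e = e \<and> e \<otimes>\<^bsub>R\<^esub> d = d \<otimes>\<^bsub>R\<^esub> e)"

definition Dedekind_finite :: "('a, 'm) ring_scheme \<Rightarrow> bool" where
  "Dedekind_finite R \<longleftrightarrow>
     (\<forall>a \<in> carrier R. \<forall>b \<in> carrier R.
        a \<otimes>\<^bsub>R\<^esub> b = \<one>\<^bsub>R\<^esub> \<longleftrightarrow> b \<otimes>\<^bsub>R\<^esub> a = \<one>\<^bsub>R\<^esub>)"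

end

theory Submission
  imports Defs
begin

text \<open>
  Suppose \<open>a b = 1\<close> and put \<open>q = 1 - b a\<close>, so \<open>q\<close> is idempotent with \<open>a q = 0\<close> and \<open>q b = 0\<close>.
  Write \<open>a = e + d\<close> as in the definition. Then \<open>e a = (1 + d) e\<close> with \<open>1 + d\<close> a unit, so \<open>a q = 0\<close>
  gives \<open>e q = 0\<close>, and \<open>a b q = q\<close> then gives \<open>e b q = 0\<close>. Hence \<open>d b q = q\<close>. As \<open>(b q)\<^sup>2 = 0\<close>, the
  element \<open>u = 1 + b q\<close> is a unit, and \<open>q = d u - d\<close> is a difference of elements of \<open>\<Delta>(R)\<close>, so
  \<open>b a = 1 - q\<close> is a unit. An idempotent unit equals \<open>1\<close>.
\<close>

context ring
begin

lemma minus_one_Units: "\<ominus> \<one> \<in> Units R"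
  unfolding Units_def by (auto intro!: bexI[of _ "\<ominus> \<one>"] simp: l_minus r_minus)

text \<open>Test membership in \<open>Delta R\<close> on the unit
  \<open>\<ominus> \<one>\<close>.\<close>

lemma one_plus_Delta_Units:
  assumes "d \<in> Delta R"
  shows "\<one> \<oplus> d \<in> Units R"
proof -
  have d: "d \<in> carrier R" and "\<one> \<ominus> d \<otimes> (\<ominus> \<one>) \<in> Units R"
    using assms minus_one_Units by (auto simp: Delta_def)
  moreover have "\<one> \<ominus> d \<otimes> (\<ominus> \<one>) = \<one> \<oplus> d"
    using d by (simp add: a_minus_def r_minus)
  ultimately show ?thesis by simp
qed

lemma one_plus_square_zero_Units:
  assumes x: "x \<in> carrier R" and xx: "x \<otimes> x = \<zero>"
  shows "\<one> \<oplus> x \<in> Units R"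
proof -
  have "(\<one> \<ominus> x) \<otimes> (\<one> \<oplus> x) = \<one>" "(\<one> \<oplus> x) \<otimes> (\<one> \<ominus> x) = \<one>"
    using x xx
    by (simp_all add: a_minus_def l_distr r_distr l_minus r_minus a_assoc r_neg l_neg)
  then show ?thesis
    using x unfolding Units_def by (auto intro!: bexI[of _ "\<one> \<ominus> x"])
qed

text \<open>With \<open>v = \<one> \<oplus> d\<close>, the element is
  \<open>v - d u = (1 - d (u v^-1)) v\<close>. Since \<open>u v^-1\<close> is a unit, the definition
  of \<open>Delta R\<close> makes the first factor a unit. This replaces closure of
  \<open>Delta R\<close> under differences.\<close>

lemma one_minus_Delta_diff_Units:
  assumes d: "d \<in> Delta R" and u: "u \<in> Units R"
  shows "\<one> \<ominus> (d \<otimes> u \<ominus> d) \<in> Units R"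
proof -
  define v where "v = \<one> \<oplus> d"
  have v: "v \<in> Units R"
    unfolding v_def using d by (rule one_plus_Delta_Units)
  have carr: "d \<in> carrier R" "u \<in> carrier R" "v \<in> carrier R" "inv v \<in> carrier R"
    using d u v by (auto simp: Delta_def)
  have "u \<otimes> inv v \<in> Units R"
    using u v by (intro Units_m_closed Units_inv_Units)
  then have "(\<one> \<ominus> d \<otimes> (u \<otimes> inv v)) \<otimes> v \<in> Units R"
    using d v by (auto simp: Delta_def)
  also have "(\<one> \<ominus> d \<otimes> (u \<otimes> inv v)) \<otimes> v = v \<ominus> d \<otimes> u"
    using carr v by (simp add: a_minus_def l_distr l_minus m_assoc)
  also have "\<dots> = \<one> \<ominus> (d \<otimes> u \<ominus> d)"
    using carr(1,2) by (simp add: v_def ring_simprules)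
  finally show ?thesis .
qed

lemma Units_mult_eq_zero:
  assumes "v \<in> Units R" "x \<in> carrier R" "v \<otimes> x = \<zero>"
  shows "x = \<zero>"
  using assms Units_l_cancel[of v x \<zero>] by auto

lemma strongly_Delta_clean_mult_eq_one:
  assumes clean: "strongly_Delta_clean R"
    and a: "a \<in> carrier R" and b: "b \<in> carrier R" and ab: "a \<otimes> b = \<one>"
  shows "b \<otimes> a = \<one>"
proof -
  obtain e d where e: "e \<in> carrier R" and dD: "d \<in> Delta R" and a_eq: "a = e \<oplus> d"
    and ee: "e \<otimes> e = e" and ed: "e \<otimes> d = d \<otimes> e"
    using clean a unfolding strongly_Delta_clean_def by blast
  have d: "d \<in> carrier R"
    using dD by (simp add: Delta_def)
  define q where "q = \<one> \<ominus> b \<otimes> a"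
  have q: "q \<in> carrier R"
    using a b by (simp add: q_def)
  have aba: "a \<otimes> (b \<otimes> a) = a"
    using a b ab by (simp flip: m_assoc)
  have bab: "b \<otimes> a \<otimes> b = b"
    using a b ab by (simp add: m_assoc)
  have aq: "a \<otimes> q = \<zero>"
    using a b aba by (simp add: q_def a_minus_def r_distr r_minus r_neg)
  have qb: "q \<otimes> b = \<zero>"
    using a b bab by (simp add: q_def a_minus_def l_distr l_minus r_neg)
  have abq: "a \<otimes> (b \<otimes> q) = q"
    using a b q ab by (simp flip: m_assoc)
  \<comment> \<open>Both sides are \<open>e \<oplus> e \<otimes> d\<close>, by idempotence and
    commutation.\<close>
  have ea: "(\<one> \<oplus> d) \<otimes> e = e \<otimes> a"
    using e d by (simp add: a_eq l_distr r_distr ee ed)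
  \<comment> \<open>As \<open>\<one> \<oplus> d\<close> is a unit, \<open>e\<close> kills
    \<open>x\<close> as soon as it kills \<open>a \<otimes> x\<close>. This is applied first to
    \<open>q\<close>, then to \<open>b \<otimes> q\<close>.\<close>
  have push: "(\<one> \<oplus> d) \<otimes> (e \<otimes> x) = e \<otimes> (a \<otimes> x)" if "x \<in> carrier R" for x
    using that e d a ea by (simp flip: m_assoc)
  note v = one_plus_Delta_Units[OF dD]
  have eq: "e \<otimes> q = \<zero>"
    using Units_mult_eq_zero[OF v, of "e \<otimes> q"] push[OF q] aq e q by simp
  have ebq: "e \<otimes> (b \<otimes> q) = \<zero>"
    using Units_mult_eq_zero[OF v, of "e \<otimes> (b \<otimes> q)"] push[of "b \<otimes> q"] abq eq e b q by simp
  have dbq: "d \<otimes> (b \<otimes> q) = q"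
    using abq ebq e d b q by (simp add: a_eq l_distr)
  \<comment> \<open>Regrouping exposes the factor \<open>q \<otimes> b\<close>, which is
    zero.\<close>
  have "b \<otimes> q \<otimes> (b \<otimes> q) = b \<otimes> (q \<otimes> b) \<otimes> q"
    using b q by (simp add: m_assoc)
  then have u: "\<one> \<oplus> b \<otimes> q \<in> Units R"
    using b q qb by (intro one_plus_square_zero_Units) simp_all
  \<comment> \<open>This puts \<open>q\<close> in the form \<open>d u - d\<close> with
    \<open>u\<close> a unit.\<close>
  have "d \<otimes> (\<one> \<oplus> b \<otimes> q) = q \<oplus> d"
    using d b q by (simp add: r_distr dbq a_comm)
  then have "d \<otimes> (\<one> \<oplus> b \<otimes> q) \<ominus> d = q"
    using d q by (simp add: a_minus_def a_assoc r_neg)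
  then have "\<one> \<ominus> q \<in> Units R"
    using one_minus_Delta_diff_Units[OF dD u] by simp
  moreover have "\<one> \<ominus> q = b \<otimes> a"
    using a b by (simp add: q_def a_minus_def minus_add r_neg2)
  ultimately have ba: "b \<otimes> a \<in> Units R"
    by simp
  have "b \<otimes> a \<otimes> (b \<otimes> a) = b \<otimes> a \<otimes> \<one>"
    using a b aba by (simp add: m_assoc)
  then show ?thesis
    using Units_l_cancel[OF ba, of "b \<otimes> a" \<one>] a b by simp
qed

end

theorem lemma2p23:
  fixes R :: "('a, 'm) ring_scheme"
  assumes "ring R" and "strongly_Delta_clean R"
  shows "Dedekind_finite R"
  using ring.strongly_Delta_clean_mult_eq_one[OF assms] unfolding Dedekind_finite_def by blast

end
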